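(* Assume that $w(u) = 1$ if $u \leq q$ and $w(u)=0$ otherwise, for some $q \in (0,1)$, and that, at a given iteration $k \in \mathbb{N}$, with current parameter $\theta_k\in\Theta$, the next proposal $p_{\theta_{k+1}}$, $\theta_{k+1}\in\Theta$, is constructed such that $$D_{\alpha}(\pi_{\theta_{k}}^f, p_{\theta_{k+1}}) + \Delta_k \leq D_{\alpha}(\pi_{\theta_k}^f, p_{\theta_k})$$ for some $\Delta_k \in \mathbb{R}$ and $\alpha \in (0,1]$, with $\alpha = 1$ corresponding to the inequality $KL(\pi_{\theta_k}^f, p_{\theta_{k+1}}) + \Delta_k \leq KL(\pi_{\theta_k}^f, p_{\theta_k})$. Write $F_{\theta_{k+1}}: u \longmapsto \mathbb{P}_{X \sim p_{\theta_{k+1}}}[f(X) \leq u]$. (i) Suppose that $\Delta_k > 0$. If $\alpha = 1$, or if $\alpha \in (0,1)$ and $W_{\theta_k}^f$ takes values in $\{0,1\}$, then $Q_{\theta_{k+1}}^q(f) \leq Q_{\theta_k}^q(f)$. (ii) If $\Delta_k > 0$ and $\mathbb{P}_{X\sim p_{\theta}} [f(X) = u] = 0$ for any $\theta \in \Theta$, $u \in \mathbb{R}$, then $Q_{\theta_{k+1}}^q(f) < Q_{\theta_k}^q(f)$. (iii) Suppose that $F_{\theta_{k+1}}$ is continuous and strictly monotonic. If $\alpha = 1$, or if $\alpha \in (0,1)$ and $W_{\theta_k}^f$ takes values in $\{0,1\}$, then $$Q_{\theta_k}^q(f) \geq F_{\theta_{k+1}}^{-1}\left(\exp(\Delta_k)\,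 F_{\theta_{k+1}}(Q_{\theta_{k+1}}^q(f))\right).$$ (iv) Suppose that $F_{\theta_{k+1}}$ is bijective and $\mathcal{C}^1$ around $Q_{\theta_{k+1}}^q(f)$ with $F_{\theta_{k+1}}'(Q_{\theta_{k+1}}^q(f)) \neq 0$. If $\alpha = 1$, or if $\alpha \in (0,1)$ and $W_{\theta_k}^f$ takes values in $\{0,1\}$, then, for $\Delta_k$ small enough, $$Q_{\theta_k}^q(f) \geq Q_{\theta_{k+1}}^q(f) + q\, \Delta_k \left(F_{\theta_{k+1}}^{-1}\right)'(q) + o(\Delta_k^2).$$
   Context: Setting: $\mathbb{X}$ is a measurable space with a measure $m$, $f:\mathbb{X}\to\mathbb{R}$ is an objective function, and $\{p_\theta,\ \theta\in\Theta\}$ is a parametric family of probability distributions on $\mathbb{X}$, each having a density with respect to $m$, also denoted $p_\theta$. For $\theta\in\Theta$ and $x\in\mathbb{X}$, set $q_\theta^{<}(x) = \mathbb{P}_{X\sim p_\theta}[f(X)<f(x)]$ and $q_\theta^{\leq}(x) = \mathbb{P}_{X\sim p_\theta}[f(X)\leq f(x)]$. Weighting: for $w:[0,1]\to\mathbb{R}_+$ non-increasing, $Z_w=\int_0^1 w(u)\,du$, and the preference function $W_\theta^f:\mathbb{X}\to\mathbb{R}$ is $W_\theta^f(x) = w(q_\theta^{\leq}(x))$ if $q_\theta^{\leq}(x)=q_\theta^{<}(x)$, and $W_\theta^f(x) = \frac{1}{q_\theta^{\leq}(x)-q_\theta^{<}(x)}\int_{q_\theta^{<}(x)}^{q_\theta^{\leq}(x)}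 w(u)\,du$ otherwise. For the indicator weighting of the claim, $Z_w=q$. The target density is $\pi_\theta^f(x)=\frac{1}{Z_w}W_\theta^f(x)p_\theta(x)$, which is a probability density with respect to $m$. Quantile: for $q\in(0,1)$, $Q_\theta^q(f)$ is the supremum of all $u\in\mathbb{R}$ such that both $\mathbb{P}_{X\sim p_\theta}[f(X)\leq u]\geq q$ and $\mathbb{P}_{X\sim p_\theta}[f(X)\geq u]\geq 1-q$. Divergences: for probability densities $p_1,p_2$ with respect to $m$, $KL(p_1,p_2)=\int \ln\left(\frac{p_1(x)}{p_2(x)}\right)p_1(x)\,m(dx)$ (with $\ln(p_1(x))p_1(x)=0$ when $p_1(x)=0$), and for $\alpha\in(0,1)\cup(1,+\infty)$, $D_\alpha(p_1,p_2)=\frac{1}{\alpha-1}\ln\left(\int p_1(x)^\alpha p_2(x)^{1-\alpha}\,m(dx)\right)$. In (iii), continuity and strict monotonicity of $F_{\theta_{k+1}}$ are understood to make it a bijection from the range of $f$ (then an interval) to $[0,1]$, with inverse $F_{\theta_{k+1}}^{-1}$. In (iv), $F_{\theta_{k+1}}^{-1}$ denotes the inverse of $F_{\theta_{k+1}}$ near $Q_{\theta_{k+1}}^q(f)$, and $o(\Delta_k^2)$ is the usual Landau notation as $\Delta_k\to 0$.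
   Formalization: In (iv), the o(Δ_k²) remainder is proved only with θ_k, θ_{k+1} both fixed, where it is nearly vacuous; uniformly in θ_k, where o(Δ_k²) fails in general (e.g. ln F_{θ_{k+1}} strictly convex near the quantile), the bound is proved with o(Δ_k) instead. *)

theory Defs
  imports "HOL-Probability.Probability" "HOL-Library.Landau_Symbols"
begin

definition prob_density_on :: "'a measure \<Rightarrow> ('a \<Rightarrow> real) \<Rightarrow> bool" where
  "prob_density_on m g \<longleftrightarrow>
     g \<in> borel_measurable m \<and> (\<forall>x\<in>space m. 0 \<le> g x) \<and> (\<integral>\<^sup>+ x. ennreal (g x) \<partial>m) = 1"

definition law :: "'a measure \<Rightarrow> ('a \<Rightarrow> real) \<Rightarrow> 'a measure" where
  "law m g = density m (\<lambda>x. ennreal (g x))"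

definition q_less :: "'a measure \<Rightarrow> ('a \<Rightarrow> real) \<Rightarrow> ('a \<Rightarrow> real) \<Rightarrow> 'a \<Rightarrow> real" where
  "q_less m f g x = \<P>(y in law m g. f y < f x)"

definition q_leq :: "'a measure \<Rightarrow> ('a \<Rightarrow> real) \<Rightarrow> ('a \<Rightarrow> real) \<Rightarrow> 'a \<Rightarrow> real" where
  "q_leq m f g x = \<P>(y in law m g. f y \<le> f x)"

definition preference ::
  "'a measure \<Rightarrow> ('a \<Rightarrow> real) \<Rightarrow> (real \<Rightarrow> real) \<Rightarrow> ('a \<Rightarrow> real) \<Rightarrow> 'a \<Rightarrow> real" where
  "preference m f w g x =
     (if q_leq m f g x = q_less m f g x then w (q_leq m f g x)
      else 1 / (q_leq m f g x - q_less m f g x) *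
             (LINT u:{q_less m f g x..q_leq m f g x}|lborel. w u))"

definition weight_mass :: "(real \<Rightarrow> real) \<Rightarrow> real" where
  "weight_mass w = (LINT u:{0..1}|lborel. w u)"

definition target ::
  "'a measure \<Rightarrow> ('a \<Rightarrow> real) \<Rightarrow> (real \<Rightarrow> real) \<Rightarrow> ('a \<Rightarrow> real) \<Rightarrow> 'a \<Rightarrow> real" where
  "target m f w g x = 1 / weight_mass w * preference m f w g x * g x"

text \<open>For \<open>0 < q < 1\<close> and a probability density \<open>g\<close>, the set below is nonempty and bounded
  above, so the supremum of reals is the genuine one.\<close>

definition quantile :: "'a measure \<Rightarrow> ('a \<Rightarrow> real) \<Rightarrow> ('a \<Rightarrow> real) \<Rightarrow> real \<Rightarrow> real" where
  "quantile m f g q =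
     Sup {u. \<P>(x in law m g. f x \<le> u) \<ge> q \<and> \<P>(x in law m g. f x \<ge> u) \<ge> 1 - q}"

definition f_cdf :: "'a measure \<Rightarrow> ('a \<Rightarrow> real) \<Rightarrow> ('a \<Rightarrow> real) \<Rightarrow> real \<Rightarrow> real" where
  "f_cdf m f g u = \<P>(x in law m g. f x \<le> u)"

text \<open>Divergences take values in \<open>ereal\<close>, since they are infinite when \<open>p1\<close> is not absolutely
  continuous with respect to \<open>p2\<close> (Kullback-Leibler, possibly also otherwise) or when \<open>p1\<close> and
  \<open>p2\<close> are mutually singular (order in \<open>(0,1)\<close>). The real-valued \<open>KL_divergence\<close> of the library
  is \<open>0\<close> for a non-integrable integrand. The map \<open>e2ennreal\<close> sends negative
  values to \<open>0\<close>, so the two integrals below are those of the positive and the negative part; the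
  latter is finite for probability densities, so the difference is never \<open>\<infinity> - \<infinity>\<close>.\<close>

definition kl_integrand :: "('a \<Rightarrow> real) \<Rightarrow> ('a \<Rightarrow> real) \<Rightarrow> 'a \<Rightarrow> ereal" where
  "kl_integrand p1 p2 x =
     (if p1 x = 0 then 0 else if p2 x = 0 then \<infinity> else ereal (ln (p1 x / p2 x) * p1 x))"

definition KL :: "'a measure \<Rightarrow> ('a \<Rightarrow> real) \<Rightarrow> ('a \<Rightarrow> real) \<Rightarrow> ereal" where
  "KL m p1 p2 =
     enn2ereal (\<integral>\<^sup>+ x. e2ennreal (kl_integrand p1 p2 x) \<partial>m) -
     enn2ereal (\<integral>\<^sup>+ x. e2ennreal (- kl_integrand p1 p2 x) \<partial>m)"

text \<open>Only meant for \<open>0 < \<alpha> < 1\<close>: the integral is then at most \<open>1\<close> for probability densities, and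
  where it vanishes \<open>ln 0 = -\<infinity>\<close> gives the value \<open>\<infinity>\<close>.\<close>

definition alpha_div :: "'a measure \<Rightarrow> real \<Rightarrow> ('a \<Rightarrow> real) \<Rightarrow> ('a \<Rightarrow> real) \<Rightarrow> ereal" where
  "alpha_div m \<alpha> p1 p2 =
     (let I = (\<integral>\<^sup>+ x. ennreal (p1 x powr \<alpha> * p2 x powr (1 - \<alpha>)) \<partial>m)
      in if I = 0 then \<infinity> else ereal (1 / (\<alpha> - 1) * ln (enn2real I)))"

definition divergence :: "'a measure \<Rightarrow> real \<Rightarrow> ('a \<Rightarrow> real) \<Rightarrow> ('a \<Rightarrow> real) \<Rightarrow> ereal" where
  "divergence m \<alpha> p1 p2 = (if \<alpha> = 1 then KL m p1 p2 else alpha_div m \<alpha> p1 p2)"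

definition improves ::
  "'a measure \<Rightarrow> ('a \<Rightarrow> real) \<Rightarrow> (real \<Rightarrow> real) \<Rightarrow> real \<Rightarrow> real \<Rightarrow> ('a \<Rightarrow> real) \<Rightarrow> ('a \<Rightarrow> real) \<Rightarrow> bool"
where
  "improves m f w \<alpha> \<Delta> g g' \<longleftrightarrow>
     divergence m \<alpha> (target m f w g) g' + ereal \<Delta> \<le> divergence m \<alpha> (target m f w g) g"

definition kl_or_01 ::
  "'a measure \<Rightarrow> ('a \<Rightarrow> real) \<Rightarrow> (real \<Rightarrow> real) \<Rightarrow> real \<Rightarrow> ('a \<Rightarrow> real) \<Rightarrow> bool" where
  "kl_or_01 m f w \<alpha> g \<longleftrightarrow>
     \<alpha> = 1 \<or> (\<alpha> \<in> {0<..<1} \<and> (\<forall>x\<in>space m. preference m f w g x \<in> {0, 1}))"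

end

theory Submission
  imports Defs
begin

text \<open>
  Let \<open>Q\<close> be the quantile of the current parameter and \<open>F\<close> the distribution function of the objective
  under the next one. Since the preference \<open>W\<close> takes values in \<open>[0, 1]\<close>, vanishes on \<open>f > Q\<close> and
  has mass \<open>q\<close> under the current density, a decrease of the divergence by \<open>\<Delta>\<close> gives, by convexity
  (Jensen for Kullback-Leibler, Hoelder for order \<open>\<alpha>\<close>), that the mass of \<open>W\<close> under the next density
  is at least \<open>q * exp \<Delta>\<close>. Hence \<open>q * exp \<Delta> \<le> F Q\<close>, and all four claims are read off by
  comparing with the quantile of the next parameter, where \<open>F\<close> crosses the level \<open>q\<close>.
\<close>

section \<open>Quantiles of a real probability distribution\<close>

context real_distribution
begin

lemma measure_lessThan_le_cdf: "u < v \<Longrightarrow> cdf M u \<le> measure M {..<v}"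
  unfolding cdf_def by (auto intro!: finite_measure_mono)

lemma measure_atLeast: "measure M {u..} = 1 - measure M {..<u}"
proof -
  have "{u..} = space M - {..<u}" by auto
  then show ?thesis
    using prob_compl[of "{..<u}"] by simp
qed

text \<open>By complement the second condition reads \<open>measure M {..<u} \<le> q\<close>, which
  holds on a ray to the left. The right end of this ray satisfies both conditions, because the left
  limit of \<open>cdf M\<close> there is the mass strictly below it and \<open>cdf M\<close> is
  right-continuous. So the supremum is a maximum.\<close>

lemma Sup_quantile_set:
  assumes q: "0 < q" "q < 1"
  defines "s \<equiv> Sup {u. q \<le> measure M {..u} \<and> 1 - q \<le> measure M {u..}}"
  shows "measure M {..<s} \<le> q" and "q \<le> measure M {..s}"
    and "\<And>u. s < u \<Longrightarrow> q < measure M {..<u}"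
proof -
  \<comment> \<open>\<open>B\<close> keeps only the second condition. The first one is recovered at
    \<open>c\<close> as a limit from the right of values that are at least \<open>q\<close>.\<close>
  define B where "B = {u. measure M {..<u} \<le> q}"
  define c where "c = Sup B"
  have "\<exists>u. cdf M u < q"
    using order_tendstoD(2)[OF cdf_lim_at_bot q(1)] by (auto simp: eventually_at_bot_linorder)
  then obtain u0 where "cdf M u0 < q" by blast
  moreover have "measure M {..<u0} \<le> cdf M u0"
    unfolding cdf_def by (auto intro!: finite_measure_mono)
  ultimately have ne: "u0 \<in> B" by (auto simp: B_def)
  have "\<exists>u. q < cdf M u"
    using order_tendstoD(1)[OF cdf_lim_at_top_prob q(2)] by (auto simp: eventually_at_top_linorder)
  then obtain u1 where u1: "q < cdf M u1" by blast
  have bdd: "bdd_above B"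
    unfolding bdd_above_def
  proof (intro exI ballI)
    fix u assume "u \<in> B"
    then show "u \<le> u1"
      using u1 measure_lessThan_le_cdf[of u1 u] by (force simp: B_def)
  qed
  have gt: "q < measure M {..<u}" if "c < u" for u
  proof (rule ccontr)
    assume "\<not> q < measure M {..<u}"
    then have "u \<in> B" by (simp add: B_def)
    then have "u \<le> c" unfolding c_def using bdd by (rule cSup_upper)
    with that show False by simp
  qed
  have le: "cdf M u \<le> q" if u: "u < c" for u
  proof -
    obtain v where "v \<in> B" "u < v"
      using u ne less_cSupE[of u B] unfolding c_def by blast
    then show ?thesis
      using measure_lessThan_le_cdf[of u v] by (auto simp: B_def)
  qed
  have below: "measure M {..<c} \<le> q"
    by (rule tendsto_upperbound[OF cdf_at_left])
       (auto simp: eventually_at_left_field intro!: le exI[of _ "c - 1"])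
  have above: "q \<le> cdf M c"
  proof (rule tendsto_lowerbound)
    show "(cdf M \<longlongrightarrow> cdf M c) (at_right c)"
      using cdf_is_right_cont by (simp add: continuous_within)
    have "q \<le> cdf M u" if "c < u" for u
    proof -
      have "measure M {..<u} \<le> cdf M u"
        unfolding cdf_def by (auto intro!: finite_measure_mono)
      then show ?thesis using gt[OF that] by simp
    qed
    then show "\<forall>\<^sub>F u in at_right c. q \<le> cdf M u"
      by (auto simp: eventually_at_right_field intro!: exI[of _ "c + 1"])
  qed simp
  have "s = c"
    unfolding s_def
  proof (rule cSup_eq_maximum)
    show "c \<in> {u. q \<le> measure M {..u} \<and> 1 - q \<le> measure M {u..}}"
      using below above by (simp add: measure_atLeast cdf_def)
    show "u \<le> c" if "u \<in> {u. q \<le> measure M {..u} \<and> 1 - q \<le> measure M {u..}}" for u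
      using that cSup_upper[OF _ bdd, of u] by (auto simp: c_def B_def measure_atLeast)
  qed
  then show "measure M {..<s} \<le> q" and "q \<le> measure M {..s}"
    and "\<And>u. s < u \<Longrightarrow> q < measure M {..<u}"
    using below above gt by (simp_all add: cdf_def)
qed

end

section \<open>Laws given by densities\<close>

lemma space_law [simp]: "space (law m g) = space m"
  by (simp add: law_def)

lemma sets_law [simp, measurable_cong]: "sets (law m g) = sets m"
  by (simp add: law_def)

lemma prob_density_onD:
  assumes "prob_density_on m g"
  shows "g \<in> borel_measurable m" "\<And>x. x \<in> space m \<Longrightarrow> 0 \<le> g x"
    "integrable m g" "(\<integral>x. g x \<partial>m) = 1"
proof -
  show meas: "g \<in> borel_measurable m" and nn: "\<And>x. x \<in> space m \<Longrightarrow> 0 \<le> g x"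
    using assms by (auto simp: prob_density_on_def)
  have "integrable m g \<and> (\<integral>x. g x \<partial>m) = 1"
    using assms meas nn nn_integral_eq_integrable[of g m 1] by (auto simp: prob_density_on_def)
  then show "integrable m g" "(\<integral>x. g x \<partial>m) = 1" by auto
qed

lemma prob_space_law: "prob_density_on m g \<Longrightarrow> prob_space (law m g)"
  by (auto intro!: prob_spaceI simp: law_def prob_density_on_def emeasure_density cong: nn_integral_cong)

lemma measure_law:
  assumes "prob_density_on m g" "A \<in> sets m"
  shows "measure (law m g) A = (\<integral>x. indicator A x * g x \<partial>m)"
proof -
  note g = prob_density_onD[OF assms(1)]
  have "emeasure (law m g) A = (\<integral>\<^sup>+x. ennreal (indicator A x * g x) \<partial>m)"
    using g assms(2) by (auto simp: law_def emeasure_density indicator_def intro!: nn_integral_cong)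
  also have "\<dots> = ennreal (\<integral>x. indicator A x * g x \<partial>m)"
    using g assms(2) by (intro nn_integral_eq_integral)
      (auto intro!: integrable_real_mult_indicator AE_I2 simp: mult.commute[of "indicator _ _"])
  finally show ?thesis
    using g by (simp add: measure_def Bochner_Integration.integral_nonneg)
qed

section \<open>Distribution of the objective and its quantile\<close>

locale objective_law =
  fixes m :: "'a measure" and f g :: "'a \<Rightarrow> real"
  assumes f_meas [measurable]: "f \<in> borel_measurable m"
    and dens: "prob_density_on m g"
begin

sublocale L: prob_space "law m g"
  using dens by (rule prob_space_law)

lemma f_rv [measurable]: "f \<in> borel_measurable (law m g)"
  using f_meas by (simp add: law_def)

sublocale D: real_distribution "distr (law m g) borel f"
  by simp

lemmas g_dens = prob_density_onD[OF dens]

lemma g_meas [measurable]: "g \<in> borel_measurable m"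
  by (rule g_dens)

lemma prob_f: "A \<in> sets borel \<Longrightarrow> \<P>(x in law m g. f x \<in> A) = measure (distr (law m g) borel f) A"
  by (simp add: measure_distr vimage_def Int_def conj_commute)

lemma f_cdf_eq: "f_cdf m f g = cdf (distr (law m g) borel f)"
  using prob_f[of "{.._}"] by (auto simp: f_cdf_def cdf_def)

lemma f_cdf_mono: "u \<le> v \<Longrightarrow> f_cdf m f g u \<le> f_cdf m f g v"
  by (simp add: f_cdf_eq D.cdf_nondecreasing)

lemma prob_less_le_f_cdf: "\<P>(x in law m g. f x < u) \<le> f_cdf m f g u"
  unfolding f_cdf_def by (intro L.finite_measure_mono) auto

lemma f_cdf_le_prob_less: "u < v \<Longrightarrow> f_cdf m f g u \<le> \<P>(x in law m g. f x < v)"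
  unfolding f_cdf_def by (intro L.finite_measure_mono) auto

lemma f_cdf_eq_prob_less:
  "\<P>(x in law m g. f x \<le> u) = \<P>(x in law m g. f x < u) + \<P>(x in law m g. f x = u)"
proof -
  have "{x \<in> space m. f x \<le> u} = {x \<in> space m. f x < u} \<union> {x \<in> space m. f x = u}" by auto
  then show ?thesis
    by simp (rule L.finite_measure_Union, auto)
qed

lemma isCont_f_cdf: "isCont (f_cdf m f g) u \<longleftrightarrow> \<P>(x in law m g. f x = u) = 0"
  using prob_f[of "{u}"] by (simp add: f_cdf_eq D.isCont_cdf)

context
  fixes q :: real
  assumes q: "0 < q" "q < 1"
begin

lemma quantile_eq: "quantile m f g q =
  Sup {u. q \<le> measure (distr (law m g) borel f) {..u} \<and>
          1 - q \<le> measure (distr (law m g) borel f) {u..}}"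
  unfolding quantile_def using prob_f[of "{.._}"] prob_f[of "{_..}"] by simp

lemma prob_less_quantile: "\<P>(x in law m g. f x < quantile m f g q) \<le> q"
  using D.Sup_quantile_set(1)[OF q] prob_f[of "{..<quantile m f g q}"] by (simp add: quantile_eq)

lemma f_cdf_quantile_ge: "q \<le> f_cdf m f g (quantile m f g q)"
  using D.Sup_quantile_set(2)[OF q] by (simp add: quantile_eq f_cdf_eq cdf_def)

lemma prob_less_above_quantile: "quantile m f g q < u \<Longrightarrow> q < \<P>(x in law m g. f x < u)"
  using D.Sup_quantile_set(3)[OF q, of u] prob_f[of "{..<u}"] by (simp add: quantile_eq)

text \<open>A point \<open>u\<close> below the quantile has distribution function at most the mass
  strictly below the quantile, hence at most \<open>q\<close>. Strictness matters: the distribution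
  function may stay at level \<open>q\<close> on an interval to the left of the quantile.\<close>

lemma quantile_le: "q < f_cdf m f g u \<Longrightarrow> quantile m f g q \<le> u"
  using prob_less_quantile f_cdf_le_prob_less[of u "quantile m f g q"] by fastforce

text \<open>Continuity excludes an atom, so the mass strictly below the quantile, at most
  \<open>q\<close>, and the mass up to it, at least \<open>q\<close>, coincide.\<close>

lemma f_cdf_quantile:
  "isCont (f_cdf m f g) (quantile m f g q) \<Longrightarrow> f_cdf m f g (quantile m f g q) = q"
  using prob_less_quantile f_cdf_quantile_ge f_cdf_eq_prob_less[of "quantile m f g q"]
  by (simp add: isCont_f_cdf f_cdf_def)

end

end

section \<open>Truncation weight, preference function and target density\<close>

locale truncation_weight =
  fixes w :: "real \<Rightarrow> real" and q :: real
  assumes q: "0 < q" "q < 1"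
    and w: "\<And>u. u \<in> {0..1} \<Longrightarrow> w u = (if u \<le> q then 1 else 0)"
begin

lemma integral_weight:
  assumes "0 \<le> a" "a \<le> b" "b \<le> 1"
  shows "(LINT u:{a..b}|lborel. w u) = min b q - min a q"
proof -
  \<comment> \<open>If \<open>q < a\<close>, the interval \<open>{a..min b q}\<close> is empty and
    both minima equal \<open>q\<close>, so the formula needs no case split.\<close>
  have "(LINT u:{a..b}|lborel. w u) = (LINT u|lborel. indicator {a..min b q} u)"
    unfolding set_lebesgue_integral_def
    using assms by (intro Bochner_Integration.integral_cong) (auto simp: w indicator_def)
  also have "\<dots> = min b q - min a q"
    using assms by (simp add: min_def)
  finally show ?thesis .
qed

lemma weight_mass_eq: "weight_mass w = q"
  using q by (simp add: weight_mass_def integral_weight)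

end

locale truncation_step = objective_law m f g + truncation_weight w q
  for m :: "'a measure" and f g :: "'a \<Rightarrow> real" and w :: "real \<Rightarrow> real" and q :: real
begin

abbreviation "Qg \<equiv> quantile m f g q"
abbreviation "W \<equiv> preference m f w g"

text \<open>Away from the level set of the quantile, all levels between \<open>q_less\<close> and
  \<open>q_leq\<close> lie on one side of \<open>q\<close>, so averaging changes nothing. On the
  level set itself, \<kappa> is the fraction of the atom that fills the mass up to exactly
  \<open>q\<close>.\<close>

lemma preference_cases:
  obtains \<kappa> where "0 \<le> \<kappa>" "\<kappa> \<le> 1"
    "\<And>x. W x = (if f x < Qg then 1 else if f x = Qg then \<kappa> else 0)"
    "\<P>(x in law m g. f x < Qg) + \<kappa> * \<P>(x in law m g. f x = Qg) = q"
proof -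
  define a where "a = \<P>(x in law m g. f x < Qg)"
  define b where "b = \<P>(x in law m g. f x \<le> Qg)"
  \<comment> \<open>Without an atom, \<open>a \<le> q \<le> b\<close> forces \<open>b = q\<close>
    and hence \<kappa> = 1; otherwise this is the average of \<open>w\<close> over
    \<open>{a..b}\<close>.\<close>
  define \<kappa> where "\<kappa> = (if a = b then w b else (q - a) / (b - a))"
  have ab: "0 \<le> a" "a \<le> q" "q \<le> b" "b \<le> 1"
    using prob_less_quantile[OF q] f_cdf_quantile_ge[OF q]
    by (simp_all add: a_def b_def f_cdf_def)
  have atom: "b = a + \<P>(x in law m g. f x = Qg)"
    unfolding a_def b_def by (rule f_cdf_eq_prob_less)
  have leq: "0 \<le> q_less m f g x" "q_less m f g x \<le> q_leq m f g x" "q_leq m f g x \<le> 1" for x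
    using prob_less_le_f_cdf[of "f x"] by (simp_all add: q_less_def q_leq_def f_cdf_def)
  have W: "W x = (if q_leq m f g x = q_less m f g x then w (q_leq m f g x)
     else (min (q_leq m f g x) q - min (q_less m f g x) q) / (q_leq m f g x - q_less m f g x))" for x
    using leq[of x] by (simp add: preference_def integral_weight)
  show thesis
  proof (rule that[of \<kappa>])
    show "0 \<le> \<kappa>" "\<kappa> \<le> 1"
      using ab w[of b] by (auto simp: \<kappa>_def divide_simps)
    show "\<P>(x in law m g. f x < Qg) + \<kappa> * \<P>(x in law m g. f x = Qg) = q"
      unfolding a_def[symmetric] using ab atom by (auto simp: \<kappa>_def)
    show "W x = (if f x < Qg then 1 else if f x = Qg then \<kappa> else 0)" for x
    proof (cases "f x" Qg rule: linorder_cases)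
      case less
      then have "q_leq m f g x \<le> q"
        using f_cdf_le_prob_less[of "f x" Qg] ab by (simp add: q_leq_def f_cdf_def a_def)
      then show ?thesis
        using less leq[of x] by (simp add: W w)
    next
      case equal
      then have "q_less m f g x = a" "q_leq m f g x = b"
        by (simp_all add: q_less_def q_leq_def a_def b_def)
      then show ?thesis
        using equal ab by (auto simp: W \<kappa>_def)
    next
      case greater
      then have "q < q_less m f g x"
        using prob_less_above_quantile[OF q, of "f x"] by (simp add: q_less_def)
      then show ?thesis
        using greater leq[of x] by (simp add: W w)
    qed
  qed
qed

lemma preference_nonneg: "0 \<le> W x" and preference_le_1: "W x \<le> 1"
  and preference_le_indicator: "W x \<le> indicator {x. f x \<le> Qg} x"
  by (rule preference_cases; simp add: indicator_def)+

lemma preference_meas [measurable]: "W \<in> borel_measurable m"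
proof -
  obtain \<kappa> where "0 \<le> \<kappa>" "\<kappa> \<le> 1"
    and W: "\<And>x. W x = (if f x < Qg then 1 else if f x = Qg then \<kappa> else 0)"
    and "\<P>(x in law m g. f x < Qg) + \<kappa> * \<P>(x in law m g. f x = Qg) = q"
    by (rule preference_cases) blast
  from W have "W = (\<lambda>x. if f x < Qg then 1 else if f x = Qg then \<kappa> else 0)" by (rule ext)
  then show ?thesis by simp
qed

lemma integrable_preference_mult:
  fixes h :: "'a \<Rightarrow> real"
  assumes "integrable m h"
  shows "integrable m (\<lambda>x. W x * h x)"
proof (rule Bochner_Integration.integrable_bound[OF assms])
  show "(\<lambda>x. W x * h x) \<in> borel_measurable m"
    using assms by measurable
  have "norm (W x * h x) \<le> norm (h x)" for x
    using preference_nonneg[of x] preference_le_1[of x]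
    by (simp add: abs_mult mult_left_le_one_le)
  then show "AE x in m. norm (W x * h x) \<le> norm (h x)" by simp
qed

text \<open>The choice of \<kappa> accounts for the exact value. Together with
  \<open>weight_mass_eq\<close> it makes the target a probability density.\<close>

lemma integral_preference: "(\<integral>x. W x * g x \<partial>m) = q"
proof -
  obtain \<kappa> where "0 \<le> \<kappa>" "\<kappa> \<le> 1"
    and W: "\<And>x. W x = (if f x < Qg then 1 else if f x = Qg then \<kappa> else 0)"
    and \<kappa>: "\<P>(x in law m g. f x < Qg) + \<kappa> * \<P>(x in law m g. f x = Qg) = q"
    by (rule preference_cases) blast
  define A where "A = {x \<in> space m. f x < Qg}"
  define B where "B = {x \<in> space m. f x = Qg}"
  have sets: "A \<in> sets m" "B \<in> sets m" by (auto simp: A_def B_def)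
  have "(\<integral>x. W x * g x \<partial>m) = (\<integral>x. indicator A x * g x + \<kappa> * (indicator B x * g x) \<partial>m)"
    by (rule Bochner_Integration.integral_cong) (auto simp: W A_def B_def indicator_def)
  also have "\<dots> = (\<integral>x. indicator A x * g x \<partial>m) + \<kappa> * (\<integral>x. indicator B x * g x \<partial>m)"
    using sets g_dens(3)
    by (subst Bochner_Integration.integral_add)
       (auto intro!: integrable_real_mult_indicator simp: mult.commute[of "indicator _ _"])
  also have "\<dots> = q"
    using \<kappa> sets by (simp add: measure_law[OF dens, symmetric] A_def B_def)
  finally show ?thesis .
qed

lemma integral_preference_le_f_cdf:
  assumes "prob_density_on m h"
  shows "(\<integral>x. W x * h x \<partial>m) \<le> f_cdf m f h Qg"
proof -
  note h = prob_density_onD[OF assms]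
  define A where "A = {x \<in> space m. f x \<le> Qg}"
  have A: "A \<in> sets m" by (simp add: A_def)
  have "(\<integral>x. W x * h x \<partial>m) \<le> (\<integral>x. indicator A x * h x \<partial>m)"
  proof (rule integral_mono)
    show "integrable m (\<lambda>x. W x * h x)" using h(3) by (rule integrable_preference_mult)
    show "integrable m (\<lambda>x. indicator A x * h x)"
      using A h(3) by (auto intro!: integrable_real_mult_indicator simp: mult.commute[of "indicator _ _"])
    show "W x * h x \<le> indicator A x * h x" if "x \<in> space m" for x
      using preference_le_indicator[of x] h(2)[OF that] that
      by (intro mult_right_mono) (auto simp: A_def indicator_def)
  qed
  also have "\<dots> = f_cdf m f h Qg"
    using A by (simp add: measure_law[OF assms, symmetric] f_cdf_def A_def)
  finally show ?thesis .
qed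

lemma target_eq: "target m f w g x = W x * g x / q"
  by (simp add: target_def weight_mass_eq)

lemma target_dens: "prob_density_on m (target m f w g)"
proof -
  have "(\<integral>\<^sup>+x. ennreal (W x * g x / q) \<partial>m) = ennreal (\<integral>x. W x * g x / q \<partial>m)"
    using q g_dens preference_nonneg
    by (intro nn_integral_eq_integral integrable_divide_zero integrable_preference_mult AE_I2) auto
  then show ?thesis
    using q g_dens(2) preference_nonneg
    by (auto simp: prob_density_on_def target_eq[abs_def] integral_preference)
qed

end

section \<open>Kullback-Leibler divergence as a real integral\<close>

lemma kl_integrand_meas [measurable]:
  assumes [measurable]: "p1 \<in> borel_measurable m" "p2 \<in> borel_measurable m"
  shows "kl_integrand p1 p2 \<in> borel_measurable m"
  unfolding kl_integrand_def[abs_def] by measurable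

text \<open>Follows from \<open>ln y \<le> y - 1\<close> at \<open>y = p2 x / p1 x\<close>. The
  bound has integral 1 for a density \<open>p2\<close>, so the negative part never makes
  \<open>KL\<close> undefined.\<close>

lemma kl_integrand_negative_part:
  assumes "0 \<le> p1 x" "0 \<le> p2 x"
  shows "e2ennreal (- kl_integrand p1 p2 x) \<le> ennreal (p2 x)"
proof (cases "p1 x = 0 \<or> p2 x = 0")
  case True
  then show ?thesis by (auto simp: kl_integrand_def e2ennreal_neg)
next
  case False
  with assms have pos: "0 < p1 x" "0 < p2 x" by auto
  then have "- ln (p1 x / p2 x) = ln (p2 x / p1 x)" by (simp add: ln_div)
  also have "\<dots> \<le> p2 x / p1 x - 1" using pos by (intro ln_le_minus_one) simp
  finally have "- (ln (p1 x / p2 x) * p1 x) \<le> (p2 x / p1 x - 1) * p1 x"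
    using pos by (metis minus_mult_left mult_right_mono less_imp_le)
  also have "\<dots> \<le> p2 x" using pos by (simp add: field_simps)
  finally show ?thesis using pos by (auto simp: kl_integrand_def intro: ennreal_leI)
qed

lemma KL_negative_part_finite:
  assumes "prob_density_on m p1" "prob_density_on m p2"
  shows "(\<integral>\<^sup>+ x. e2ennreal (- kl_integrand p1 p2 x) \<partial>m) < \<infinity>"
proof -
  have "(\<integral>\<^sup>+ x. e2ennreal (- kl_integrand p1 p2 x) \<partial>m) \<le> (\<integral>\<^sup>+ x. ennreal (p2 x) \<partial>m)"
    using assms by (intro nn_integral_mono kl_integrand_negative_part) (auto simp: prob_density_on_def)
  also have "\<dots> = 1" using assms(2) by (simp add: prob_density_on_def)
  finally show ?thesis by (rule le_less_trans) simp
qed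

text \<open>As the negative part has finite integral, a divergence other than \<infinity> has a
  finite positive part as well. The extended integrand is then finite almost everywhere, which is
  absolute continuity, and it agrees almost everywhere with the real one.\<close>

lemma KL_finite:
  assumes dens: "prob_density_on m p1" "prob_density_on m p2"
    and fin: "KL m p1 p2 \<noteq> \<infinity>"
  shows "AE x in m. p1 x = 0 \<or> p2 x \<noteq> 0"
    and "integrable m (\<lambda>x. ln (p1 x / p2 x) * p1 x)"
    and "KL m p1 p2 = ereal (\<integral>x. ln (p1 x / p2 x) * p1 x \<partial>m)"
proof -
  define h where "h x = ln (p1 x / p2 x) * p1 x" for x
  have [measurable]: "p1 \<in> borel_measurable m" "p2 \<in> borel_measurable m"
    using dens by (auto simp: prob_density_on_def)
  then have [measurable]: "h \<in> borel_measurable m" by (simp add: h_def[abs_def])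
  define P where "P = (\<integral>\<^sup>+ x. e2ennreal (kl_integrand p1 p2 x) \<partial>m)"
  define N where "N = (\<integral>\<^sup>+ x. e2ennreal (- kl_integrand p1 p2 x) \<partial>m)"
  have KL: "KL m p1 p2 = enn2ereal P - enn2ereal N" by (simp add: KL_def P_def N_def)
  have N: "N \<noteq> \<infinity>" using KL_negative_part_finite[OF dens] by (simp add: N_def)
  have P: "P \<noteq> \<infinity>" using fin N by (cases N) (auto simp: KL)
  have "AE x in m. e2ennreal (kl_integrand p1 p2 x) \<noteq> \<infinity>"
    using P unfolding P_def by (intro nn_integral_PInf_AE) auto
  then show ac: "AE x in m. p1 x = 0 \<or> p2 x \<noteq> 0"
    by eventually_elim (auto simp: kl_integrand_def split: if_splits)
  then have kl: "AE x in m. kl_integrand p1 p2 x = ereal (h x)"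
    by eventually_elim (auto simp: kl_integrand_def h_def)
  have P': "P = (\<integral>\<^sup>+ x. ennreal (h x) \<partial>m)"
    unfolding P_def using kl by (intro nn_integral_cong_AE) auto
  have N': "N = (\<integral>\<^sup>+ x. ennreal (- h x) \<partial>m)"
    unfolding N_def using kl by (intro nn_integral_cong_AE) auto
  have int: "integrable m h"
    using P N by (simp add: real_integrable_def P' N')
  then show "integrable m (\<lambda>x. ln (p1 x / p2 x) * p1 x)" by (simp add: h_def[abs_def])
  have "integral\<^sup>L m h = enn2real P - enn2real N"
    using real_lebesgue_integral_def[OF int] by (simp add: P' N')
  then have "KL m p1 p2 = ereal (integral\<^sup>L m h)"
    using P N by (cases P; cases N) (auto simp: KL)
  then show "KL m p1 p2 = ereal (\<integral>x. ln (p1 x / p2 x) * p1 x \<partial>m)" by (simp add: h_def[abs_def])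
qed

section \<open>From a decrease of the divergence to mass of the preference\<close>

context truncation_step
begin

text \<open>Where the target is positive, its ratio to \<open>g\<close> is
  \<open>W x / q \<le> 1 / q\<close>, so the logarithm is at most \<open>ln (1 / q)\<close>. This
  rules out the trivial case \<infinity> \<le> \<infinity> of the improvement inequality.\<close>

lemma KL_target_self_finite: "KL m (target m f w g) g \<noteq> \<infinity>"
proof -
  let ?t = "target m f w g"
  have "e2ennreal (kl_integrand ?t g x) \<le> ennreal (ln (1 / q)) * ennreal (?t x)"
    if "x \<in> space m" for x
  proof (cases "?t x = 0")
    case True
    then show ?thesis by (simp add: kl_integrand_def e2ennreal_neg)
  next
    case False
    then have nz: "W x \<noteq> 0" "g x \<noteq> 0" by (auto simp: target_eq)
    then have pos: "0 < W x" "0 < g x"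
      using preference_nonneg[of x] g_dens(2)[OF that] by auto
    then have "ln (?t x / g x) \<le> ln (1 / q)"
      using q preference_le_1[of x] by (auto simp: target_eq intro!: divide_right_mono)
    moreover have "0 < ?t x" using pos q by (simp add: target_eq)
    ultimately have "ln (?t x / g x) * ?t x \<le> ln (1 / q) * ?t x" by simp
    then show ?thesis
      using \<open>0 < ?t x\<close> pos q
      by (auto simp: kl_integrand_def ennreal_mult[symmetric] ln_div intro!: ennreal_leI)
  qed
  then have "(\<integral>\<^sup>+ x. e2ennreal (kl_integrand ?t g x) \<partial>m)
      \<le> (\<integral>\<^sup>+ x. ennreal (ln (1 / q)) * ennreal (?t x) \<partial>m)"
    by (rule nn_integral_mono)
  also have "\<dots> = ennreal (ln (1 / q))"
    using target_dens by (simp add: nn_integral_cmult prob_density_on_def)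
  finally have "(\<integral>\<^sup>+ x. e2ennreal (kl_integrand ?t g x) \<partial>m) < \<infinity>"
    by (rule le_less_trans) simp
  moreover have "(\<integral>\<^sup>+ x. e2ennreal (- kl_integrand ?t g x) \<partial>m) < \<infinity>"
    by (rule KL_negative_part_finite[OF target_dens dens])
  ultimately show ?thesis
    unfolding KL_def
    by (cases "\<integral>\<^sup>+ x. e2ennreal (kl_integrand ?t g x) \<partial>m";
        cases "\<integral>\<^sup>+ x. e2ennreal (- kl_integrand ?t g x) \<partial>m") auto
qed

text \<open>Instead of Jensen's inequality: integrate \<open>ln y \<le> y - 1\<close> at \<open>y = exp (- \<Delta>) * h / g\<close>
  against the target.\<close>

lemma KL_improves_mass:
  assumes h: "prob_density_on m h"
    and le: "KL m (target m f w g) h + ereal \<Delta> \<le> KL m (target m f w g) g"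
  shows "q * exp \<Delta> \<le> (\<integral>x. W x * h x \<partial>m)"
proof -
  let ?t = "target m f w g"
  define S where "S = (\<integral>x. W x * h x \<partial>m)"
  note h_dens = prob_density_onD[OF h]
  note t_dens = prob_density_onD[OF target_dens]
  have fin: "KL m ?t h \<noteq> \<infinity>"
    using le KL_target_self_finite by auto
  note kg = KL_finite[OF target_dens dens KL_target_self_finite]
  note kh = KL_finite[OF target_dens h fin]
  have intW: "integrable m (\<lambda>x. exp (- \<Delta>) / q * (W x * h x))"
    using h_dens(3) by (intro integrable_mult_right integrable_preference_mult) auto
  \<comment> \<open>The two divergence integrands stay on opposite sides, each integrable by itself.
    Where the target vanishes, the left side is 0 and the right side nonnegative.\<close>
  have "AE x in m. ln (?t x / g x) * ?t x + (1 - \<Delta>) * ?t x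
      \<le> ln (?t x / h x) * ?t x + exp (- \<Delta>) / q * (W x * h x)"
    using kh(1)
  proof (rule AE_mp, intro AE_I2 impI)
    fix x assume x: "x \<in> space m" and ac: "?t x = 0 \<or> h x \<noteq> 0"
    show "ln (?t x / g x) * ?t x + (1 - \<Delta>) * ?t x
      \<le> ln (?t x / h x) * ?t x + exp (- \<Delta>) / q * (W x * h x)"
    proof (cases "?t x = 0")
      case True
      then show ?thesis using h_dens(2)[OF x] preference_nonneg[of x] q by simp
    next
      case False
      then have pos: "0 < W x" "0 < g x" "0 < h x" "0 < ?t x"
        using ac preference_nonneg[of x] g_dens(2)[OF x] h_dens(2)[OF x] q
        by (auto simp: target_eq less_le)
      have "ln (exp (- \<Delta>) * h x / g x) \<le> exp (- \<Delta>) * h x / g x - 1"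
        using pos by (intro ln_le_minus_one) simp
      moreover have "ln (exp (- \<Delta>) * h x / g x) = - \<Delta> + ln (h x) - ln (g x)"
        using pos by (simp add: ln_div ln_mult)
      ultimately have "(1 - \<Delta> + ln (h x) - ln (g x)) * ?t x \<le> exp (- \<Delta>) * h x / g x * ?t x"
        using pos by (intro mult_right_mono) auto
      also have "\<dots> = exp (- \<Delta>) / q * (W x * h x)"
        using pos by (simp add: target_eq field_simps)
      finally show ?thesis
        using pos by (simp add: ln_div algebra_simps)
    qed
  qed
  then have "(\<integral>x. ln (?t x / g x) * ?t x + (1 - \<Delta>) * ?t x \<partial>m)
    \<le> (\<integral>x. ln (?t x / h x) * ?t x + exp (- \<Delta>) / q * (W x * h x) \<partial>m)"
    using kg(2) kh(2) t_dens(3) intW by (intro integral_mono_AE) auto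
  also have "(\<integral>x. ln (?t x / g x) * ?t x + (1 - \<Delta>) * ?t x \<partial>m)
    = (\<integral>x. ln (?t x / g x) * ?t x \<partial>m) + (1 - \<Delta>)"
    using kg(2) t_dens(3,4) by simp
  also have "(\<integral>x. ln (?t x / h x) * ?t x + exp (- \<Delta>) / q * (W x * h x) \<partial>m)
    = (\<integral>x. ln (?t x / h x) * ?t x \<partial>m) + exp (- \<Delta>) / q * S"
    using kh(2) intW by (simp add: S_def)
  \<comment> \<open>The assumed decrease by \<Delta> cancels the \<open>- \<Delta>\<close> on the
    left together with both divergences.\<close>
  finally have "1 \<le> exp (- \<Delta>) / q * S"
    using le unfolding kg(3) kh(3) by simp
  then show ?thesis
    using q by (simp add: S_def exp_minus field_simps)
qed

text \<open>The divergence from the target to \<open>g\<close> equals \<open>- ln q\<close>, so the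
  assumption bounds the integral \<open>I\<close> from below. Young's inequality bounds
  \<open>I\<close> from above by an affine function of \<open>S\<close>, and comparing the two
  bounds isolates \<open>S\<close>.\<close>

lemma alpha_improves_mass:
  assumes h: "prob_density_on m h" and \<alpha>: "0 < \<alpha>" "\<alpha> < 1"
    and W01: "\<And>x. x \<in> space m \<Longrightarrow> W x \<in> {0, 1}"
    and le: "alpha_div m \<alpha> (target m f w g) h + ereal \<Delta> \<le> alpha_div m \<alpha> (target m f w g) g"
  shows "q * exp \<Delta> \<le> (\<integral>x. W x * h x \<partial>m)"
proof -
  let ?t = "target m f w g"
  define S where "S = (\<integral>x. W x * h x \<partial>m)"
  note h_dens = prob_density_onD[OF h]
  define I where "I = (\<integral>\<^sup>+ x. ennreal (?t x powr \<alpha> * h x powr (1 - \<alpha>)) \<partial>m)"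
  \<comment> \<open>Scaling \<open>h\<close> by \<open>s\<close> balances Young's inequality: for
    \<open>S = q * exp \<Delta>\<close> both of its terms integrate against \<open>W\<close> to
    multiples of \<open>q\<close>. The constant \<open>C\<close> collects the factor from the target
    and undoes the scaling, so that the lower bound for \<open>I\<close> is exactly
    \<open>C * q\<close>.\<close>
  define s where "s = exp (- \<Delta>)"
  define C where "C = q powr (- \<alpha>) * s powr (- (1 - \<alpha>))"
  \<comment> \<open>The values 0 and 1 enter here, through
    \<open>W x powr \<alpha> = W x\<close>.\<close>
  have t_powr: "?t x powr \<alpha> = q powr (- \<alpha>) * (W x * g x powr \<alpha>)" if "x \<in> space m" for x
    using W01[OF that] q g_dens(2)[OF that]
    by (auto simp: target_eq powr_divide powr_minus_divide)
  have "(\<integral>\<^sup>+ x. ennreal (?t x powr \<alpha> * g x powr (1 - \<alpha>)) \<partial>m)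
      = (\<integral>\<^sup>+ x. ennreal (q powr (- \<alpha>) * (W x * g x)) \<partial>m)"
  proof (rule nn_integral_cong)
    fix x assume x: "x \<in> space m"
    have "g x powr \<alpha> * g x powr (1 - \<alpha>) = g x"
      using g_dens(2)[OF x] by (simp add: powr_add[symmetric])
    then show "ennreal (?t x powr \<alpha> * g x powr (1 - \<alpha>)) = ennreal (q powr (- \<alpha>) * (W x * g x))"
      by (simp add: t_powr[OF x] mult.assoc)
  qed
  also have "\<dots> = ennreal (\<integral>x. q powr (- \<alpha>) * (W x * g x) \<partial>m)"
    using g_dens preference_nonneg
    by (intro nn_integral_eq_integral integrable_mult_right integrable_preference_mult AE_I2) auto
  also have "\<dots> = ennreal (q powr (1 - \<alpha>))"
    using q by (simp add: integral_preference powr_diff powr_minus_divide)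
  finally have "alpha_div m \<alpha> ?t g = ereal (- ln q)"
    using q \<alpha> by (simp add: alpha_div_def Let_def ln_powr field_simps)
  \<comment> \<open>For \<open>I = 0\<close> the divergence to \<open>h\<close> would be
    \<infinity>, while the right-hand side is \<open>- ln q\<close>.\<close>
  with le have I0: "I \<noteq> 0" and lnI: "1 / (\<alpha> - 1) * ln (enn2real I) + \<Delta> \<le> - ln q"
    by (auto simp: alpha_div_def Let_def I_def split: if_splits)
  have young: "?t x powr \<alpha> * h x powr (1 - \<alpha>)
      \<le> C * (\<alpha> * (W x * g x) + (1 - \<alpha>) * s * (W x * h x))" if x: "x \<in> space m" for x
  \<comment> \<open>Young's inequality is applied to positive arguments only. If a factor vanishes,
    the left side is 0 since \<open>0 powr\<close> any exponent is 0.\<close>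
  proof (cases "W x = 0 \<or> g x = 0 \<or> h x = 0")
    case True
    then show ?thesis
      using preference_nonneg[of x] g_dens(2)[OF x] h_dens(2)[OF x] \<alpha>
      by (auto simp: t_powr[OF x] C_def s_def)
  next
    case False
    then have pos: "W x = 1" "0 < g x" "0 < h x"
      using W01[OF x] g_dens(2)[OF x] h_dens(2)[OF x] by auto
    have "g x powr \<alpha> * (s * h x) powr (1 - \<alpha>) \<le> \<alpha> * g x + (1 - \<alpha>) * (s * h x)"
      using pos \<alpha> by (intro Youngs_inequality_0) (auto simp: s_def)
    then have "C * (g x powr \<alpha> * (s * h x) powr (1 - \<alpha>)) \<le> C * (\<alpha> * g x + (1 - \<alpha>) * (s * h x))"
      by (intro mult_left_mono) (auto simp: C_def)
    also have "C * (g x powr \<alpha> * (s * h x) powr (1 - \<alpha>))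
      = (s powr (- (1 - \<alpha>)) * s powr (1 - \<alpha>)) * (?t x powr \<alpha> * h x powr (1 - \<alpha>))"
      using pos by (simp add: t_powr[OF x] C_def powr_mult s_def)
    also have "s powr (- (1 - \<alpha>)) * s powr (1 - \<alpha>) = 1"
      by (simp add: s_def powr_add[symmetric])
    finally show ?thesis using pos by (simp add: mult.assoc)
  qed
  have int: "integrable m (\<lambda>x. W x * g x)" "integrable m (\<lambda>x. W x * h x)"
    using g_dens(3) h_dens(3) by (auto intro: integrable_preference_mult)
  have S: "0 \<le> S"
    unfolding S_def using h_dens(2) preference_nonneg
    by (intro Bochner_Integration.integral_nonneg) auto
  have "I \<le> (\<integral>\<^sup>+ x. ennreal (C * (\<alpha> * (W x * g x) + (1 - \<alpha>) * s * (W x * h x))) \<partial>m)"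
    unfolding I_def using young by (intro nn_integral_mono ennreal_leI)
  also have "\<dots> = ennreal (\<integral>x. C * (\<alpha> * (W x * g x) + (1 - \<alpha>) * s * (W x * h x)) \<partial>m)"
    using int \<alpha> g_dens(2) h_dens(2) preference_nonneg
    by (intro nn_integral_eq_integral AE_I2) (auto simp: C_def s_def)
  also have "(\<integral>x. C * (\<alpha> * (W x * g x) + (1 - \<alpha>) * s * (W x * h x)) \<partial>m)
      = C * (\<alpha> * q + (1 - \<alpha>) * s * S)"
    using int by (simp add: integral_preference S_def)
  finally have I_le: "I \<le> ennreal (C * (\<alpha> * q + (1 - \<alpha>) * s * S))" .
  then have "I \<noteq> \<infinity>" by (auto simp: top_unique)
  with I0 have I_pos: "0 < enn2real I"
    by (simp add: enn2real_positive_iff less_top zero_less_iff_neq_zero)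
  have "enn2real I \<le> C * (\<alpha> * q + (1 - \<alpha>) * s * S)"
    using enn2real_mono[OF I_le] S q \<alpha> by (simp add: C_def s_def)
  moreover have "(1 - \<alpha>) * (ln q + \<Delta>) \<le> ln (enn2real I)"
    using lnI \<alpha> by (simp add: divide_simps split: if_splits) (simp add: algebra_simps)
  then have "exp ((1 - \<alpha>) * (ln q + \<Delta>)) \<le> enn2real I"
    using I_pos by (metis exp_le_cancel_iff exp_ln)
  moreover have "exp ((1 - \<alpha>) * (ln q + \<Delta>)) = C * q"
  proof -
    have "C * q = exp (- \<alpha> * ln q) * exp ((1 - \<alpha>) * \<Delta>) * exp (ln q)"
      using q by (simp add: C_def s_def powr_def algebra_simps)
    also have "\<dots> = exp ((1 - \<alpha>) * (ln q + \<Delta>))"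
      unfolding exp_add[symmetric] by (simp add: algebra_simps)
    finally show ?thesis by simp
  qed
  ultimately have "C * q \<le> C * (\<alpha> * q + (1 - \<alpha>) * s * S)" by linarith
  moreover have "0 < C" using q by (simp add: C_def s_def)
  ultimately have "q \<le> \<alpha> * q + (1 - \<alpha>) * s * S" by (simp only: mult_le_cancel_left_pos)
  then have "(1 - \<alpha>) * q \<le> (1 - \<alpha>) * (s * S)" by (simp add: algebra_simps)
  then have "q \<le> s * S" using \<alpha> by simp
  then show ?thesis by (simp add: S_def s_def exp_minus field_simps)
qed

lemma improves_f_cdf_ge:
  assumes "prob_density_on m h" "0 < \<alpha>" "\<alpha> \<le> 1"
    and "improves m f w \<alpha> \<Delta> g h" "kl_or_01 m f w \<alpha> g"
  shows "q * exp \<Delta> \<le> f_cdf m f h Qg"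
proof -
  have "q * exp \<Delta> \<le> (\<integral>x. W x * h x \<partial>m)"
    using assms KL_improves_mass alpha_improves_mass
    by (cases "\<alpha> = 1") (auto simp: improves_def divergence_def kl_or_01_def)
  also have "\<dots> \<le> f_cdf m f h Qg"
    using assms(1) by (rule integral_preference_le_f_cdf)
  finally show ?thesis .
qed

text \<open>Without atoms the averaging branch of the preference is never taken. This makes
  \<open>kl_or_01\<close> automatic in the second claim.\<close>

lemma preference_01:
  assumes "\<And>u. \<P>(x in law m g. f x = u) = 0"
  shows "W x \<in> {0, 1}"
proof -
  have "q_leq m f g x = q_less m f g x"
    using f_cdf_eq_prob_less[of "f x"] assms by (simp add: q_leq_def q_less_def)
  moreover have "0 \<le> q_leq m f g x" "q_leq m f g x \<le> 1"
    by (simp_all add: q_leq_def)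
  ultimately show ?thesis by (simp add: preference_def w)
qed

text \<open>Otherwise the event \<open>f < Qg\<close>, of mass at most \<open>q < 1\<close>, would
  be the whole space.\<close>

lemma ex_quantile_le: "\<exists>x\<in>space m. Qg \<le> f x"
proof (rule ccontr)
  assume "\<not> ?thesis"
  then have "{x \<in> space (law m g). f x < Qg} = space (law m g)" by auto
  then show False
    using prob_less_quantile[OF q] L.prob_space q by simp
qed

end

section \<open>Local inverse of a monotone function and its expansion\<close>

lemma local_inverse_of_mono:
  fixes F :: "real \<Rightarrow> real"
  assumes "mono F"
    and U: "open U" "c \<in> U" and inj: "inj_on F U"
    and C1: "F C1_differentiable_on U" and nz: "deriv F c \<noteq> 0"
  defines "G \<equiv> the_inv_into U F"
  shows "G (F c) = c" and "0 \<le> deriv G (F c)"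
    and "(G has_real_derivative deriv G (F c)) (at (F c))"
    and "\<forall>\<^sub>F y in nhds (F c). \<forall>v. y \<le> F v \<longrightarrow> G y \<le> v"
proof -
  have GF: "G (F z) = z" if "z \<in> U" for z
    unfolding G_def using inj that by (rule the_inv_into_f_f)
  then show Gc: "G (F c) = c" using U by simp
  obtain F' where F': "\<And>z. z \<in> U \<Longrightarrow> (F has_real_derivative F' z) (at z)"
    using C1 unfolding C1_differentiable_on_def has_real_derivative_iff_has_vector_derivative by auto
  then have cont: "continuous_on U F"
    by (auto intro!: continuous_at_imp_continuous_on DERIV_isCont)
  have DF: "(F has_real_derivative deriv F c) (at c)"
    using F'[OF U(2)] DERIV_imp_deriv by metis
  have D_pos: "0 \<le> deriv F c"
    by (rule mono_on_imp_deriv_nonneg[of UNIV F]) (auto intro: \<open>mono F\<close> DF)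
  \<comment> \<open>Inverse function theorem; the sign of the derivative of \<open>G\<close> comes
    from monotonicity of \<open>F\<close>.\<close>
  have "(G has_derivative (*) (inverse (deriv F c))) (at (F c))"
  proof (rule has_derivative_inverse_strong[OF U cont])
    show "(F has_derivative (*) (deriv F c)) (at c)"
      using DF by (simp add: has_field_derivative_def)
    show "(*) (deriv F c) \<circ> (*) (inverse (deriv F c)) = id"
      using nz by (auto simp: fun_eq_iff)
  qed (rule GF)
  then have DG: "(G has_real_derivative inverse (deriv F c)) (at (F c))"
    by (simp add: has_field_derivative_def)
  then show "(G has_real_derivative deriv G (F c)) (at (F c))" and "0 \<le> deriv G (F c)"
    using D_pos by (simp_all add: DERIV_imp_deriv)
  have strict: "F u < F v" if "u < v" "u \<in> U" "v \<in> U" for u v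
    using monoD[OF \<open>mono F\<close>, of u v] that inj by (auto simp: inj_on_def less_le)
  obtain d where d: "0 < d" "cball c d \<subseteq> U"
    using U by (auto simp: open_contains_cball)
  then have seg: "{c - d..c + d} \<subseteq> U" by (simp add: cball_eq_atLeastAtMost)
  have "F (c - d) < F c" "F c < F (c + d)"
    using d(1) seg by (auto intro!: strict U simp: subset_eq)
  then have "\<forall>\<^sub>F y in nhds (F c). y \<in> {F (c - d)<..<F (c + d)}"
    by (intro eventually_nhds_in_open) auto
  then show "\<forall>\<^sub>F y in nhds (F c). \<forall>v. y \<le> F v \<longrightarrow> G y \<le> v"
  proof eventually_elim
    case (elim y)
    \<comment> \<open>By the intermediate value theorem on the closed segment inside
      \<open>U\<close>, \<open>y\<close> has a preimage \<open>z\<close> in \<open>U\<close>, so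
      \<open>G y = z\<close>.\<close>
    then obtain z where z: "c - d \<le> z" "z \<le> c + d" "F z = y"
      using IVT'[of F "c - d" y "c + d"] d(1) continuous_on_subset[OF cont seg] by auto
    have "z \<noteq> c - d" using z elim by auto
    show ?case
    proof (intro allI impI)
      fix v assume v: "y \<le> F v"
      have "z \<le> v"
      proof (rule ccontr)
        assume "\<not> z \<le> v"
        \<comment> \<open>The point \<open>v\<close> may lie outside \<open>U\<close>, where
          \<open>F\<close> is only weakly monotone. Replacing it by \<open>max v (c - d)\<close>
          moves it into the segment, still below \<open>z\<close>, without decreasing
          \<open>F\<close>.\<close>
        with z \<open>z \<noteq> c - d\<close> have "F (max v (c - d)) < F z"
          by (intro strict) (use seg in \<open>auto simp: subset_eq\<close>)
        then show False
          using monoD[OF \<open>mono F\<close> max.cobounded1[of v "c - d"]] v z by linarith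
      qed
      then show "G y \<le> v" using GF[of z] z seg by auto
    qed
  qed
qed

text \<open>The chain rule gives derivative \<open>D * a\<close> at 0, since
  \<open>a * exp 0 = a\<close>. The estimate includes \<Delta> = 0, so the filter can be
  \<open>nhds 0\<close>.\<close>

lemma first_order_expansion_exp:
  fixes G :: "real \<Rightarrow> real"
  assumes "(G has_real_derivative D) (at a)"
  shows "(\<lambda>\<Delta>. G (a * exp \<Delta>) - G a - a * \<Delta> * D) \<in> o[nhds 0](\<lambda>\<Delta>. \<Delta>)"
proof (rule landau_o.smallI)
  fix e :: real assume "0 < e"
  have "((\<lambda>\<Delta>. G (a * exp \<Delta>)) has_real_derivative D * a) (at 0)"
    using assms by (auto intro!: derivative_eq_intros DERIV_chain2[where f = G])
  then obtain d where "0 < d"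
    and d: "\<And>y. norm (y - 0) < d \<Longrightarrow>
      norm (G (a * exp y) - G (a * exp 0) - D * a * (y - 0)) \<le> e * norm (y - 0)"
    using \<open>0 < e\<close> unfolding has_field_derivative_def has_derivative_at_alt by blast
  then show "\<forall>\<^sub>F y in nhds 0. norm (G (a * exp y) - G a - a * y * D) \<le> e * norm y"
    by (auto simp: eventually_nhds_metric dist_real_def mult_ac intro!: exI[of _ d])
qed

lemma tendsto_mult_exp_nhds_0: "((\<lambda>\<Delta>. a * exp \<Delta>) \<longlongrightarrow> a) (nhds (0::real))"
proof -
  have "((\<lambda>\<Delta>. a * exp \<Delta>) \<longlongrightarrow> a * exp 0) (nhds (0::real))"
    by (intro tendsto_intros filterlim_ident)
  then show ?thesis by simp
qed

section \<open>The four claims on the quantiles\<close>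

theorem corollary1:
  fixes m :: "'a measure" and f :: "'a \<Rightarrow> real"
    and \<Theta> :: "'t set" and p :: "'t \<Rightarrow> 'a \<Rightarrow> real"
    and w :: "real \<Rightarrow> real" and q \<alpha> :: real
    and \<theta> \<theta>' :: 't
    and Q :: "'t \<Rightarrow> real" and F :: "real \<Rightarrow> real"
  assumes f_meas: "f \<in> borel_measurable m"
    and dens: "\<And>t. t \<in> \<Theta> \<Longrightarrow> prob_density_on m (p t)"
    and q: "0 < q" "q < 1"
    and w: "\<And>u. u \<in> {0..1} \<Longrightarrow> w u = (if u \<le> q then 1 else 0)"
    and \<alpha>: "0 < \<alpha>" "\<alpha> \<le> 1"
    and \<theta>: "\<theta> \<in> \<Theta>" and \<theta>': "\<theta>' \<in> \<Theta>"
  defines "Q \<equiv> \<lambda>t. quantile m f (p t) q"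
    and "F \<equiv> f_cdf m f (p \<theta>')"
  shows
    "(\<forall>\<Delta>. improves m f w \<alpha> \<Delta> (p \<theta>) (p \<theta>') \<and> \<Delta> > 0 \<and> kl_or_01 m f w \<alpha> (p \<theta>) \<longrightarrow>
        Q \<theta>' \<le> Q \<theta>) \<and>
     (\<forall>\<Delta>. improves m f w \<alpha> \<Delta> (p \<theta>) (p \<theta>') \<and> \<Delta> > 0 \<and>
        (\<forall>t\<in>\<Theta>. \<forall>u. \<P>(x in law m (p t). f x = u) = 0) \<longrightarrow>
        Q \<theta>' < Q \<theta>) \<and>
     (\<forall>\<Delta>. improves m f w \<alpha> \<Delta> (p \<theta>) (p \<theta>') \<and> kl_or_01 m f w \<alpha> (p \<theta>) \<and>
        continuous_on UNIV F \<and> strict_mono_on (f ` space m) F \<and>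
        {0<..<1} \<subseteq> F ` (f ` space m) \<longrightarrow>
        exp \<Delta> * F (Q \<theta>') \<in> F ` (f ` space m) \<and>
        Q \<theta> \<ge> the_inv_into (f ` space m) F (exp \<Delta> * F (Q \<theta>'))) \<and>
     (\<forall>U. open U \<and> Q \<theta>' \<in> U \<and> inj_on F U \<and> F C1_differentiable_on U \<and> deriv F (Q \<theta>') \<noteq> 0 \<longrightarrow>
        (kl_or_01 m f w \<alpha> (p \<theta>) \<longrightarrow>
          (\<exists>r. r \<in> o[nhds 0](\<lambda>\<Delta>. \<Delta>\<^sup>2) \<and>
            (\<forall>\<^sub>F \<Delta> in nhds 0. improves m f w \<alpha> \<Delta> (p \<theta>) (p \<theta>') \<longrightarrow>
              Q \<theta> \<ge> Q \<theta>' + q * \<Delta> * deriv (the_inv_into U F) q + r \<Delta>))) \<and>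
        (\<exists>r. r \<in> o[nhds 0](\<lambda>\<Delta>. \<Delta>) \<and>
            (\<forall>\<^sub>F \<Delta> in nhds 0. \<forall>t\<in>\<Theta>. kl_or_01 m f w \<alpha> (p t) \<and>
              improves m f w \<alpha> \<Delta> (p t) (p \<theta>') \<longrightarrow>
              Q t \<ge> Q \<theta>' + q * \<Delta> * deriv (the_inv_into U F) q + r \<Delta>)))"
proof -
  have step: "truncation_step m f (p t) w q" if "t \<in> \<Theta>" for t
    using f_meas dens[OF that] q w
    by (auto simp: truncation_step_def objective_law_def truncation_weight_def)
  interpret N: truncation_step m f "p \<theta>'" w q using \<theta>' by (rule step)
  \<comment> \<open>Kept general in \<open>t\<close> for the version of the fourth claim that is
    uniform over the current parameter.\<close>
  have key: "q * exp \<Delta> \<le> F (Q t)"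
    if "t \<in> \<Theta>" "improves m f w \<alpha> \<Delta> (p t) (p \<theta>')" "kl_or_01 m f w \<alpha> (p t)" for t \<Delta>
    using truncation_step.improves_f_cdf_ge[OF step N.dens \<alpha>] that by (simp add: F_def Q_def)
  have F_mono: "F u \<le> F v" if "u \<le> v" for u v
    using that unfolding F_def by (rule N.f_cdf_mono)
  have lt: "q < q * exp \<Delta>" if "0 < \<Delta>" for \<Delta>
    using q that by simp
  have F_Q: "F (Q \<theta>') = q" if "isCont F (Q \<theta>')"
    using N.f_cdf_quantile[OF q] that by (simp add: F_def Q_def)

  have i: "Q \<theta>' \<le> Q \<theta>"
    if "improves m f w \<alpha> \<Delta> (p \<theta>) (p \<theta>')" "\<Delta> > 0" "kl_or_01 m f w \<alpha> (p \<theta>)" for \<Delta>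
    using key[OF \<theta> that(1,3)] lt[OF that(2)] N.quantile_le[OF q]
    by (simp add: F_def Q_def)

  have ii: "Q \<theta>' < Q \<theta>"
    if imp: "improves m f w \<alpha> \<Delta> (p \<theta>) (p \<theta>')" and "\<Delta> > 0"
      and atomless: "\<forall>t\<in>\<Theta>. \<forall>u. \<P>(x in law m (p t). f x = u) = 0" for \<Delta>
  proof -
    have "kl_or_01 m f w \<alpha> (p \<theta>)"
      using truncation_step.preference_01[OF step[OF \<theta>]] atomless \<theta> \<alpha>
      by (auto simp: kl_or_01_def)
    with key[OF \<theta> imp] lt[OF \<open>\<Delta> > 0\<close>] have "q < F (Q \<theta>)" by simp
    \<comment> \<open>Continuity pins \<open>F\<close> to \<open>q\<close> at the next quantile, so
      \<open>q < F (Q \<theta>)\<close> separates the quantiles strictly.\<close>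
    moreover have "F (Q \<theta>') = q"
      using atomless \<theta>' by (intro F_Q) (simp add: F_def N.isCont_f_cdf)
    ultimately show ?thesis using F_mono[of "Q \<theta>" "Q \<theta>'"] by force
  qed

  have iii: "exp \<Delta> * F (Q \<theta>') \<in> F ` (f ` space m) \<and>
      Q \<theta> \<ge> the_inv_into (f ` space m) F (exp \<Delta> * F (Q \<theta>'))"
    if imp: "improves m f w \<alpha> \<Delta> (p \<theta>) (p \<theta>')" and kl: "kl_or_01 m f w \<alpha> (p \<theta>)"
      and cont: "continuous_on UNIV F" and strict: "strict_mono_on (f ` space m) F"
      and range: "{0<..<1} \<subseteq> F ` (f ` space m)" for \<Delta>
  proof
    interpret T: truncation_step m f "p \<theta>" w q using \<theta> by (rule step)
    define y where "y = the_inv_into (f ` space m) F (exp \<Delta> * F (Q \<theta>'))"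
    have FQ: "F (Q \<theta>') = q"
      using cont by (intro F_Q) (simp add: continuous_on_eq_continuous_at)
    have le: "exp \<Delta> * F (Q \<theta>') \<le> F (Q \<theta>)"
      using key[OF \<theta> imp kl] by (simp add: FQ mult.commute)
    \<comment> \<open>This point handles the level 1, which the open interval in
      \<open>range\<close> omits: a level that is at least 1 is squeezed between 1 and
      \<open>F (f x0) \<le> 1\<close>.\<close>
    obtain x0 where x0: "x0 \<in> space m" "Q \<theta> \<le> f x0"
      using T.ex_quantile_le by (auto simp: Q_def)
    have "F (f x0) \<le> 1" by (simp add: F_def f_cdf_def)
    with le F_mono[OF x0(2)] have le1: "exp \<Delta> * F (Q \<theta>') \<le> F (f x0)" "F (f x0) \<le> 1"
      by simp_all
    show im: "exp \<Delta> * F (Q \<theta>') \<in> F ` (f ` space m)"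
    proof (cases "exp \<Delta> * F (Q \<theta>') < 1")
      case True
      then have "exp \<Delta> * F (Q \<theta>') \<in> {0<..<1}" using q by (simp add: FQ)
      with range show ?thesis by (rule subsetD)
    next
      case False
      with le1 have "exp \<Delta> * F (Q \<theta>') = F (f x0)" by linarith
      with x0(1) show ?thesis by blast
    qed
    have inj: "inj_on F (f ` space m)"
      using strict by (rule strict_mono_on_imp_inj_on)
    have y: "y \<in> f ` space m" "F y = exp \<Delta> * F (Q \<theta>')"
      unfolding y_def using the_inv_into_into[OF inj im] f_the_inv_into_f[OF inj im] by auto
    \<comment> \<open>\<open>F\<close> is strictly monotone only on the range of \<open>f\<close>,
      which may miss \<open>Q \<theta>\<close>. If \<open>Q \<theta> < y\<close>, the current law
      has more mass below \<open>y\<close> than below \<open>Q \<theta>\<close>, so some value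
      \<open>f x\<close> lies between; there strictness applies and yields
      \<open>F (Q \<theta>) < F y\<close>.\<close>
    have "y \<le> Q \<theta>"
    proof (rule ccontr)
      assume "\<not> y \<le> Q \<theta>"
      then have "\<P>(x in law m (p \<theta>). f x < Q \<theta>) < \<P>(x in law m (p \<theta>). f x < y)"
        using T.prob_less_quantile[OF q] T.prob_less_above_quantile[OF q, of y]
        by (simp add: Q_def)
      then have "\<exists>x\<in>space m. Q \<theta> \<le> f x \<and> f x < y"
        using \<open>\<not> y \<le> Q \<theta>\<close> T.L.finite_measure_mono[of "{x \<in> space m. f x < y}" "{x \<in> space m. f x < Q \<theta>}"]
        by (force simp: not_less)
      then obtain x where x: "x \<in> space m" "Q \<theta> \<le> f x" "f x < y" by blast
      have "F (f x) < F y"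
        using strict_mono_onD[OF strict _ y(1) x(3)] x(1) by simp
      then show False using F_mono[OF x(2)] le y by simp
    qed
    then show "Q \<theta> \<ge> the_inv_into (f ` space m) F (exp \<Delta> * F (Q \<theta>'))"
      by (simp add: y_def)
  qed

  have iv: "(kl_or_01 m f w \<alpha> (p \<theta>) \<longrightarrow>
        (\<exists>r. r \<in> o[nhds 0](\<lambda>\<Delta>. \<Delta>\<^sup>2) \<and>
          (\<forall>\<^sub>F \<Delta> in nhds 0. improves m f w \<alpha> \<Delta> (p \<theta>) (p \<theta>') \<longrightarrow>
            Q \<theta> \<ge> Q \<theta>' + q * \<Delta> * deriv (the_inv_into U F) q + r \<Delta>))) \<and>
      (\<exists>r. r \<in> o[nhds 0](\<lambda>\<Delta>. \<Delta>) \<and>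
          (\<forall>\<^sub>F \<Delta> in nhds 0. \<forall>t\<in>\<Theta>. kl_or_01 m f w \<alpha> (p t) \<and>
            improves m f w \<alpha> \<Delta> (p t) (p \<theta>') \<longrightarrow>
            Q t \<ge> Q \<theta>' + q * \<Delta> * deriv (the_inv_into U F) q + r \<Delta>))"
    if U: "open U" "Q \<theta>' \<in> U" and inj: "inj_on F U" and C1: "F C1_differentiable_on U"
      and nz: "deriv F (Q \<theta>') \<noteq> 0" for U
  proof
    define G where "G = the_inv_into U F"
    have "isCont F (Q \<theta>')"
      using C1_differentiable_imp_continuous_on[OF C1] U by (simp add: continuous_on_eq_continuous_at)
    then have FQ: "F (Q \<theta>') = q" by (rule F_Q)
    have "mono F" by (rule monoI) (rule F_mono)
    note inv = local_inverse_of_mono[OF \<open>mono F\<close> U inj C1 nz, folded G_def, unfolded FQ]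
    have inv_le: "\<forall>\<^sub>F \<Delta> in nhds 0. \<forall>v. q * exp \<Delta> \<le> F v \<longrightarrow> G (q * exp \<Delta>) \<le> v"
      using inv(4) tendsto_mult_exp_nhds_0 by (rule eventually_compose_filterlim)
    show "\<exists>r. r \<in> o[nhds 0](\<lambda>\<Delta>. \<Delta>) \<and>
          (\<forall>\<^sub>F \<Delta> in nhds 0. \<forall>t\<in>\<Theta>. kl_or_01 m f w \<alpha> (p t) \<and>
            improves m f w \<alpha> \<Delta> (p t) (p \<theta>') \<longrightarrow>
            Q t \<ge> Q \<theta>' + q * \<Delta> * deriv (the_inv_into U F) q + r \<Delta>)"
    \<comment> \<open>The remainder is that of \<open>G (q * exp \<Delta>)\<close> at \<Delta> = 0.
      It does not involve \<open>t\<close>, whence uniformity; \<open>G\<close> is only known to be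
      differentiable at \<open>q\<close>, whence the first order.\<close>
    proof (intro exI conjI)
      show "(\<lambda>\<Delta>. G (q * exp \<Delta>) - G q - q * \<Delta> * deriv G q) \<in> o[nhds 0](\<lambda>\<Delta>. \<Delta>)"
        using inv(3) by (rule first_order_expansion_exp)
      show "\<forall>\<^sub>F \<Delta> in nhds 0. \<forall>t\<in>\<Theta>. kl_or_01 m f w \<alpha> (p t) \<and>
            improves m f w \<alpha> \<Delta> (p t) (p \<theta>') \<longrightarrow>
            Q t \<ge> Q \<theta>' + q * \<Delta> * deriv (the_inv_into U F) q +
              (G (q * exp \<Delta>) - G q - q * \<Delta> * deriv G q)"
        using inv_le by eventually_elim (auto simp: G_def[symmetric] inv(1) intro: key)
    qed
    show "kl_or_01 m f w \<alpha> (p \<theta>) \<longrightarrow>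
        (\<exists>r. r \<in> o[nhds 0](\<lambda>\<Delta>. \<Delta>\<^sup>2) \<and>
          (\<forall>\<^sub>F \<Delta> in nhds 0. improves m f w \<alpha> \<Delta> (p \<theta>) (p \<theta>') \<longrightarrow>
            Q \<theta> \<ge> Q \<theta>' + q * \<Delta> * deriv (the_inv_into U F) q + r \<Delta>))"
      \<comment> \<open>With both parameters fixed, \<open>r = 0\<close> works: the difference of the quantiles is
        independent of \<open>\<Delta>\<close>, and if it is negative then no small \<open>\<Delta>\<close> is admissible.\<close>
    proof (intro impI exI conjI)
      show "(\<lambda>_. 0) \<in> o[nhds 0](\<lambda>\<Delta>::real. \<Delta>\<^sup>2)" by simp
      assume kl: "kl_or_01 m f w \<alpha> (p \<theta>)"
      show "\<forall>\<^sub>F \<Delta> in nhds 0. improves m f w \<alpha> \<Delta> (p \<theta>) (p \<theta>') \<longrightarrow>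
            Q \<theta> \<ge> Q \<theta>' + q * \<Delta> * deriv (the_inv_into U F) q + 0"
      proof (cases "Q \<theta>" "Q \<theta>'" rule: linorder_cases)
        case less
        \<comment> \<open>Otherwise \<open>inv(4)\<close> at the level \<open>q\<close> itself would
          give \<open>Q \<theta>' = G q \<le> Q \<theta>\<close>.\<close>
        have "F (Q \<theta>) < q"
          using eventually_nhds_x_imp_x[OF inv(4)] less inv(1) by (metis not_le)
        with tendsto_mult_exp_nhds_0 have "\<forall>\<^sub>F \<Delta> in nhds 0. F (Q \<theta>) < q * exp \<Delta>"
          by (rule order_tendstoD)
        then show ?thesis
          by eventually_elim (use key[OF \<theta> _ kl] in force)
      next
        case equal
        have "q * \<Delta> * deriv G q \<le> 0" if "improves m f w \<alpha> \<Delta> (p \<theta>) (p \<theta>')" for \<Delta>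
        proof -
          \<comment> \<open>Equal quantiles give \<open>F (Q \<theta>) = q\<close>, so
            \<open>key\<close> leaves no room for a positive \<Delta>; with the nonnegative
            derivative of \<open>G\<close> the linear term is then at most 0.\<close>
          have "\<Delta> \<le> 0"
            using key[OF \<theta> that kl] lt[of \<Delta>] by (force simp: equal FQ)
          then show ?thesis
            using q inv(2) by (simp add: mult_nonpos_nonneg mult_nonneg_nonpos)
        qed
        then show ?thesis by (auto simp: equal G_def intro!: always_eventually)
      next
        case greater
        have "((\<lambda>\<Delta>. Q \<theta>' + q * \<Delta> * deriv G q) \<longlongrightarrow> Q \<theta>' + q * 0 * deriv G q) (nhds 0)"
          by (intro tendsto_intros filterlim_ident)
        then have "\<forall>\<^sub>F \<Delta> in nhds 0. Q \<theta>' + q * \<Delta> * deriv G q < Q \<theta>"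
          using greater by (intro order_tendstoD(2)) auto
        then show ?thesis
          by eventually_elim (simp add: G_def)
      qed
    qed
  qed

  show ?thesis
    using i ii iii iv by blast
qed

end
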